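(* Let $q$ be a prime power, let $n,t,u,r,k_1,k$ be integers with $t,u,r\ge 0$, $k_1=n-1-r\ge 1$, $k=k_1+1$, and $u\le \min\{n,q-1\}$. Assume there is an $[n,k,d]_q$ code $\mathcal{C}$ with $d\ge 2t+1$ that has a $k\times n$ generator matrix of the form $$\boldsymbol{G}=\begin{bmatrix}\boldsymbol{G}_1\\ \boldsymbol{G}_0\end{bmatrix}=\begin{bmatrix}\boldsymbol{0}_{k_1\times 1} & \boldsymbol{I}_{k_1} & \boldsymbol{P}_{k_1\times r}\\ 1 & \boldsymbol{1}_{1\times k_1} & \boldsymbol{1}_{1\times r}\end{bmatrix},$$ where $\boldsymbol{P}\in\mathbb{F}_q^{k_1\times r}$ and $\boldsymbol{G}_1$ is a $k_1\times n$ generator matrix of an $[n,k_1]_q$ code $\mathcal{C}_1$. Then this code, with the encoder and decoder described below, is a $(u,t)$-PSMC for partially-stuck-at-$1$ cells, with message space $\mathbb{F}_q^{k_1}$: it masks any $u$ partially-stuck-at-$1$ cells and corrects any $t$ additional errors while storing $k_1=n-r-1$ information symbols. Encoder: given $\boldsymbol{m}\in\mathbb{F}_q^{k_1}$ and the set $\boldsymbol{\phi}=\{\phi_0,\dots,\phi_{u-1}\}\subseteq\{0,\dots,n-1\}$ of partially stuck positions, compute $\boldsymbol{w}=\boldsymbol{m}\boldsymbol{G}_1$, choose $v\in\mathbb{F}_q$ with $w_{\phi_i}\ne v$ for all $i$ (such a $v$ always exists), put $z_0=-v$, and output $\boldsymbol{c}=\boldsymbol{w}+z_0\boldsymbol{G}_0$.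 Decoder: given $\boldsymbol{y}=\boldsymbol{c}+\boldsymbol{e}$, decode $\boldsymbol{y}$ in $\mathcal{C}$ to the codeword $\hat{\boldsymbol{c}}$ (unique codeword within Hamming distance $t$), let $\hat z_0$ be the first entry of $\hat{\boldsymbol{c}}$, compute $\hat{\boldsymbol{w}}=(\hat w_0,\dots,\hat w_{n-1})=\hat{\boldsymbol{c}}-\hat z_0\boldsymbol{G}_0$, and output $\hat{\boldsymbol{m}}=(\hat w_1,\dots,\hat w_{k_1})$.
   Context: $\mathbb{F}_q$ is the finite field with $q$ elements; its elements are identified with the memory levels $0,1,\dots,q-1$, with the field's zero element corresponding to level $0$. All arithmetic is in $\mathbb{F}_q$. Positions of vectors of length $n$ are indexed $0,\dots,n-1$. An $[n,k,d]_q$ code is a linear code over $\mathbb{F}_q$ of length $n$, dimension $k$ and minimum Hamming distance $d$. $\boldsymbol{0}_{a\times b}$, $\boldsymbol{1}_{a\times b}$ are all-zero and all-one matrices, and $\boldsymbol{I}_a$ is the identity matrix. A memory cell is partially stuck at level $s$ if it can store only values that are at least $s$; thus a cell partially stuck at level $1$ can store exactly the nonzero elements of $\mathbb{F}_q$. A $(u,t)$-PSMC (partially-stuck-at-masking code) of length $n$ for partially-stuck-at-$1$ cells, with message space $\mathcal{M}$, is a pair (encoder, decoder). The encoder takes as input any set $\boldsymbol{\phi}=\{\phi_0,\dots,\phi_{u-1}\}\subseteq\{0,\dots,n-1\}$ of $u$ positions (all partially stuck at level $1$) and any message $\boldsymbol{m}\in\mathcal{M}$, and outputs $\boldsymbol{c}\in\mathbb{F}_q^n$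 with $c_{\phi_i}\ge 1$ (i.e. $c_{\phi_i}\neq 0$) for all $i=0,\dots,u-1$. The decoder, which does not know $\boldsymbol{\phi}$, takes as input $\boldsymbol{c}+\boldsymbol{e}$ and returns the correct message $\boldsymbol{m}$ for every error vector $\boldsymbol{e}\in\mathbb{F}_q^n$ of Hamming weight at most $t$. *)

theory Defs
  imports "Jordan_Normal_Form.VS_Connect"
begin

definition hamming_distance :: "'a vec \<Rightarrow> 'a vec \<Rightarrow> nat" where
  "hamming_distance x y = card {i. i < dim_vec x \<and> x $ i \<noteq> y $ i}"

definition hamming_weight :: "'a::zero vec \<Rightarrow> nat" where
  "hamming_weight x = card {i. i < dim_vec x \<and> x $ i \<noteq> 0}"

text \<open>Meaningful only for a code with at least two codewords, since Min of the empty set is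
  unspecified.\<close>

definition minimum_distance :: "'a vec set \<Rightarrow> nat" where
  "minimum_distance C = Min {hamming_distance x y |x y. x \<in> C \<and> y \<in> C \<and> x \<noteq> y}"

text \<open>The field is a type of class field and finite, so its order is a prime power.
  In the locale \<open>vec_space\<close> the ambient space \<open>V\<close> consists of the vectors of length \<open>n\<close> over it.\<close>

definition (in vec_space) linear_code :: "nat \<Rightarrow> 'a vec set \<Rightarrow> bool" where
  "linear_code k C \<longleftrightarrow>
     VectorSpace.subspace class_ring C V \<and> vectorspace.dim class_ring (vs C) = k"

definition (in vec_space) linear_code_dist :: "nat \<Rightarrow> nat \<Rightarrow> 'a vec set \<Rightarrow> bool" where
  "linear_code_dist k d C \<longleftrightarrow> linear_code k C \<and> minimum_distance C = d"

definition (in vec_space) generator_matrix :: "nat \<Rightarrow> 'a mat \<Rightarrow> 'a vec set \<Rightarrow> bool" where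
  "generator_matrix k G C \<longleftrightarrow>
     G \<in> carrier_mat k n \<and> distinct (rows G) \<and> lin_indpt (set (rows G)) \<and> row_space G = C"

definition append_cols :: "'a::zero mat \<Rightarrow> 'a mat \<Rightarrow> 'a mat" (infixr \<open>@\<^sub>c\<close> 65) where
  "A @\<^sub>c B = four_block_mat A B (0\<^sub>m 0 (dim_col A)) (0\<^sub>m 0 (dim_col B))"

definition ones_mat :: "nat \<Rightarrow> nat \<Rightarrow> 'a::one mat" where
  "ones_mat a b = mat a b (\<lambda>_. 1)"

definition psmc_G1 :: "nat \<Rightarrow> 'a::field mat \<Rightarrow> 'a mat" where
  "psmc_G1 k1 P = 0\<^sub>m k1 1 @\<^sub>c 1\<^sub>m k1 @\<^sub>c P"

definition psmc_G0 :: "nat \<Rightarrow> nat \<Rightarrow> 'a::field mat" where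
  "psmc_G0 k1 r = 1\<^sub>m 1 @\<^sub>c ones_mat 1 k1 @\<^sub>c ones_mat 1 r"

text \<open>The row vector \<open>x A\<close>; the matrix library only multiplies by vectors from the right.\<close>

definition row_vec_mult :: "'a::field vec \<Rightarrow> 'a mat \<Rightarrow> 'a vec" where
  "row_vec_mult x A = transpose_mat A *\<^sub>v x"

text \<open>\<open>level\<close> identifies the field elements with the memory levels; a cell that is partially stuck
  at level \<open>s\<close> can store exactly the values of level at least \<open>s\<close>.\<close>

definition level_identification :: "nat \<Rightarrow> ('a::zero \<Rightarrow> nat) \<Rightarrow> bool" where
  "level_identification q level \<longleftrightarrow> bij_betw level UNIV {0..<q} \<and> level 0 = 0"

definition storable :: "('a \<Rightarrow> nat) \<Rightarrow> nat \<Rightarrow> 'a \<Rightarrow> bool" where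
  "storable level s x \<longleftrightarrow> s \<le> level x"

definition stuck_sets :: "nat \<Rightarrow> nat \<Rightarrow> nat set set" where
  "stuck_sets n u = {\<phi>. \<phi> \<subseteq> {0..<n} \<and> card \<phi> = u}"

definition is_PSMC ::
  "('a::field \<Rightarrow> nat) \<Rightarrow> nat \<Rightarrow> nat \<Rightarrow> nat \<Rightarrow> 'm set \<Rightarrow>
   (nat set \<Rightarrow> 'm \<Rightarrow> 'a vec) \<Rightarrow> ('a vec \<Rightarrow> 'm) \<Rightarrow> bool" where
  "is_PSMC level n u t M enc dec \<longleftrightarrow>
     (\<forall>\<phi>\<in>stuck_sets n u. \<forall>m\<in>M.
        enc \<phi> m \<in> carrier_vec n \<and>
        (\<forall>i\<in>\<phi>. storable level 1 (enc \<phi> m $ i)) \<and>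
        (\<forall>e\<in>carrier_vec n. hamming_weight e \<le> t \<longrightarrow> dec (enc \<phi> m + e) = m))"

text \<open>The scalar \<open>v\<close> chosen by the encoder for stuck positions \<open>\<phi>\<close> and message \<open>m\<close> is
  \<open>choice \<phi> m\<close>; any function that meets the requirement \<open>masking_scalar\<close> is allowed.\<close>

definition masking_scalar :: "'a::field mat \<Rightarrow> nat set \<Rightarrow> 'a vec \<Rightarrow> 'a \<Rightarrow> bool" where
  "masking_scalar G1 \<phi> m v \<longleftrightarrow> (\<forall>i\<in>\<phi>. row_vec_mult m G1 $ i \<noteq> v)"

definition psmc_encoder ::
  "'a::field mat \<Rightarrow> 'a mat \<Rightarrow> (nat set \<Rightarrow> 'a vec \<Rightarrow> 'a) \<Rightarrow> nat set \<Rightarrow> 'a vec \<Rightarrow> 'a vec" where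
  "psmc_encoder G1 G0 choice \<phi> m =
     (let w = row_vec_mult m G1; z0 = - choice \<phi> m in w + z0 \<cdot>\<^sub>v row G0 0)"

definition nearby_codeword :: "'a vec set \<Rightarrow> nat \<Rightarrow> 'a vec \<Rightarrow> 'a vec \<Rightarrow> bool" where
  "nearby_codeword C t y x \<longleftrightarrow> x \<in> C \<and> hamming_distance x y \<le> t"

definition psmc_decoder ::
  "'a::field vec set \<Rightarrow> nat \<Rightarrow> nat \<Rightarrow> 'a mat \<Rightarrow> 'a vec \<Rightarrow> 'a vec" where
  "psmc_decoder C t k1 G0 y =
     (let c = (THE x. nearby_codeword C t y x);
          z0 = c $ 0;
          w = c - z0 \<cdot>\<^sub>v row G0 0
      in vec k1 (\<lambda>j. w $ (j + 1)))"

end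

theory Submission
  imports Defs
begin

text \<open>A vector over $\mathbb{F}_q$ takes at most $u \le q - 1$ values on the stuck positions, so some
  $v$ is avoided there, and subtracting $v$ everywhere makes all stuck entries nonzero. The result is
  the combination of rows of \<open>G\<close> with coefficients $(m, -v)$, hence a codeword, and as $d \ge 2t + 1$
  it is the only codeword within distance $t$ of the received vector. Since \<open>G\<^sub>1\<close> starts with a zero
  column followed by an identity block, the first entry of the codeword is $-v$, and once the
  multiple of \<open>G\<^sub>0\<close> is removed the next $k_1$ entries are the message.\<close>

lemma hamming_distance_le_dim: "hamming_distance x y \<le> dim_vec x"
  unfolding hamming_distance_def
  using card_mono[of "{..<dim_vec x}" "{i. i < dim_vec x \<and> x $ i \<noteq> y $ i}"] by auto

text \<open>The indices counted are those of the first argument, so symmetry relies on equal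
  lengths.\<close>

lemma hamming_distance_commute:
  "dim_vec x = dim_vec y \<Longrightarrow> hamming_distance x y = hamming_distance y x"
  unfolding hamming_distance_def by (metis (lifting))

lemma hamming_distance_triangle:
  assumes "dim_vec x = dim_vec y"
  shows "hamming_distance x z \<le> hamming_distance x y + hamming_distance y z"
proof -
  have "{i. i < dim_vec x \<and> x $ i \<noteq> z $ i} \<subseteq>
      {i. i < dim_vec x \<and> x $ i \<noteq> y $ i} \<union> {i. i < dim_vec y \<and> y $ i \<noteq> z $ i}"
    using assms by auto
  then have "hamming_distance x z \<le>
      card ({i. i < dim_vec x \<and> x $ i \<noteq> y $ i} \<union> {i. i < dim_vec y \<and> y $ i \<noteq> z $ i})"
    unfolding hamming_distance_def by (intro card_mono) auto
  then show ?thesis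
    unfolding hamming_distance_def by (rule order_trans[OF _ card_Un_le])
qed

lemma hamming_distance_add:
  fixes x e :: "'a::ring vec"
  assumes "x \<in> carrier_vec n" "e \<in> carrier_vec n"
  shows "hamming_distance x (x + e) = hamming_weight e"
proof -
  have "{i. i < dim_vec x \<and> x $ i \<noteq> (x + e) $ i} = {i. i < dim_vec e \<and> e $ i \<noteq> 0}"
    using assms by auto
  then show ?thesis
    unfolding hamming_distance_def hamming_weight_def by simp
qed

text \<open>\<open>Min\<close> is a lower bound only for a finite set; distances from vectors of
  length \<open>n\<close> are at most \<open>n\<close>, which supplies the finiteness.\<close>

lemma minimum_distance_le:
  assumes "C \<subseteq> carrier_vec n" "x \<in> C" "y \<in> C" "x \<noteq> y"
  shows "minimum_distance C \<le> hamming_distance x y"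
proof -
  have "hamming_distance x y \<le> n" if "x \<in> C" for x y
    using that assms(1) hamming_distance_le_dim[of x y] by auto
  then have "{hamming_distance x y |x y. x \<in> C \<and> y \<in> C \<and> x \<noteq> y} \<subseteq> {..n}"
    by auto
  then have "finite {hamming_distance x y |x y. x \<in> C \<and> y \<in> C \<and> x \<noteq> y}"
    by (rule finite_subset) simp
  then show ?thesis
    unfolding minimum_distance_def using assms(2-) by (intro Min_le) auto
qed

text \<open>Two codewords within distance \<open>t\<close> of the same word are at most
  \<open>2 * t\<close> apart, below the minimum distance, so they coincide. The equivalence gives
  existence as well as uniqueness, as needed to evaluate the \<open>THE\<close> in the
  decoder.\<close>

lemma nearby_codeword_add_iff:
  fixes C :: "'a::field vec set"
  assumes C: "C \<subseteq> carrier_vec n" "2 * t + 1 \<le> minimum_distance C"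
    and c: "c \<in> C" and e: "e \<in> carrier_vec n" "hamming_weight e \<le> t"
  shows "nearby_codeword C t (c + e) x \<longleftrightarrow> x = c"
proof
  have cn: "c \<in> carrier_vec n" using C c by auto
  have near: "hamming_distance c (c + e) \<le> t"
    using hamming_distance_add[OF cn e(1)] e(2) by simp
  show "nearby_codeword C t (c + e) x" if "x = c"
    using that near c by (simp add: nearby_codeword_def)
  assume "nearby_codeword C t (c + e) x"
  then have x: "x \<in> C" "hamming_distance x (c + e) \<le> t"
    by (auto simp: nearby_codeword_def)
  then have xn: "x \<in> carrier_vec n" using C by auto
  have "hamming_distance x c \<le> hamming_distance x (c + e) + hamming_distance (c + e) c"
    using xn e(1) by (intro hamming_distance_triangle) auto
  also have "hamming_distance (c + e) c = hamming_distance c (c + e)"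
    using cn e(1) by (intro hamming_distance_commute) auto
  finally have "hamming_distance x c \<le> 2 * t"
    using x(2) near by linarith
  then show "x = c"
    using minimum_distance_le[OF C(1) x(1) c] C(2) by fastforce
qed

lemma row_vec_mult_carrier:
  "A \<in> carrier_mat nr nc \<Longrightarrow> row_vec_mult x A \<in> carrier_vec nc"
  unfolding row_vec_mult_def carrier_vec_def by simp

lemma index_row_vec_mult:
  "A \<in> carrier_mat nr nc \<Longrightarrow> j < nc \<Longrightarrow> row_vec_mult x A $ j = col A j \<bullet> x"
  unfolding row_vec_mult_def by simp

text \<open>Membership in a code with a given generator matrix thus reduces to exhibiting a
  coefficient vector.\<close>

lemma (in vec_space) row_space_eq_row_vec_mult:
  "A \<in> carrier_mat nr n \<Longrightarrow> row_space A = (\<lambda>x. row_vec_mult x A) ` carrier_vec nr"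
  using row_space_eq[of A nr] row_vec_mult_carrier[of A nr n]
  unfolding row_vec_mult_def by auto

lemma col_append_rows:
  assumes "A \<in> carrier_mat nr1 nc" "B \<in> carrier_mat nr2 nc" "j < nc"
  shows "col (A @\<^sub>r B) j = col A j @\<^sub>v col B j"
  using assms by (intro eq_vecI) (auto simp: append_rows_def)

text \<open>Each column of the stacked matrix is a concatenation of two columns, so its scalar
  product with \<open>x @\<^sub>v y\<close> splits. This separates the message part of a codeword
  from the masking part.\<close>

lemma row_vec_mult_append_rows:
  assumes A: "A \<in> carrier_mat nr1 nc" and B: "B \<in> carrier_mat nr2 nc"
    and x: "x \<in> carrier_vec nr1" and y: "y \<in> carrier_vec nr2"
  shows "row_vec_mult (x @\<^sub>v y) (A @\<^sub>r B) = row_vec_mult x A + row_vec_mult y B"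
proof (rule eq_vecI)
  have AB: "A @\<^sub>r B \<in> carrier_mat (nr1 + nr2) nc" using A B by auto
  note car = row_vec_mult_carrier[OF A, of x] row_vec_mult_carrier[OF B, of y]
    row_vec_mult_carrier[OF AB, of "x @\<^sub>v y"]
  show "dim_vec (row_vec_mult (x @\<^sub>v y) (A @\<^sub>r B)) = dim_vec (row_vec_mult x A + row_vec_mult y B)"
    using car by simp
  fix j assume "j < dim_vec (row_vec_mult x A + row_vec_mult y B)"
  then have j: "j < nc" using car by simp
  have "(col A j @\<^sub>v col B j) \<bullet> (x @\<^sub>v y) = col A j \<bullet> x + col B j \<bullet> y"
    using A B x y j by (intro scalar_prod_append) auto
  then show "row_vec_mult (x @\<^sub>v y) (A @\<^sub>r B) $ j = (row_vec_mult x A + row_vec_mult y B) $ j"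
    using car j
    by (simp add: index_row_vec_mult[OF A] index_row_vec_mult[OF B] index_row_vec_mult[OF AB]
        col_append_rows[OF A B])
qed

lemma row_vec_mult_single_row:
  assumes "B \<in> carrier_mat 1 nc"
  shows "row_vec_mult (vec 1 (\<lambda>_. z)) B = z \<cdot>\<^sub>v row B 0"
  using assms
  by (intro eq_vecI) (auto simp: row_vec_mult_def scalar_prod_def)

lemma psmc_G1_carrier:
  "P \<in> carrier_mat k1 r \<Longrightarrow> psmc_G1 k1 P \<in> carrier_mat k1 (1 + k1 + r)"
  unfolding psmc_G1_def append_cols_def by (auto intro!: carrier_matI)

lemma psmc_G0_carrier: "psmc_G0 k1 r \<in> carrier_mat 1 (1 + k1 + r)"
  unfolding psmc_G0_def append_cols_def ones_mat_def by (auto intro!: carrier_matI)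

lemma row_psmc_G0: "row (psmc_G0 k1 r) 0 = vec (1 + k1 + r) (\<lambda>_. 1)"
  by (intro eq_vecI) (auto simp: psmc_G0_def append_cols_def ones_mat_def)

lemma col_psmc_G1_0: "P \<in> carrier_mat k1 r \<Longrightarrow> col (psmc_G1 k1 P) 0 = 0\<^sub>v k1"
  by (intro eq_vecI) (auto simp: psmc_G1_def append_cols_def)

lemma col_psmc_G1_Suc:
  "P \<in> carrier_mat k1 r \<Longrightarrow> j < k1 \<Longrightarrow> col (psmc_G1 k1 P) (Suc j) = unit_vec k1 j"
  by (intro eq_vecI) (auto simp: psmc_G1_def append_cols_def)

text \<open>The masking term is the product of a one-entry vector with a one-row matrix, so both
  summands merge into a single combination of rows of the generator matrix; this places the output
  in the code.\<close>

lemma psmc_encoder_eq_row_vec_mult: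
  assumes "P \<in> carrier_mat k1 r" "m \<in> carrier_vec k1"
  shows "psmc_encoder (psmc_G1 k1 P) (psmc_G0 k1 r) choice \<phi> m =
    row_vec_mult (m @\<^sub>v vec 1 (\<lambda>_. - choice \<phi> m)) (psmc_G1 k1 P @\<^sub>r psmc_G0 k1 r)"
  using assms
    row_vec_mult_append_rows[OF psmc_G1_carrier psmc_G0_carrier, of P k1 r m "vec 1 (\<lambda>_. - choice \<phi> m)"]
    row_vec_mult_single_row[OF psmc_G0_carrier, of "- choice \<phi> m" k1 r]
  by (simp add: psmc_encoder_def Let_def)

text \<open>The row of \<open>psmc_G0 k1 r\<close> is all ones, so masking shifts every entry
  equally. The formula serves twice: for the stuck entries and for reading the message back.\<close>

lemma index_psmc_encoder:
  assumes "P \<in> carrier_mat k1 r" "i < 1 + k1 + r"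
  shows "psmc_encoder (psmc_G1 k1 P) (psmc_G0 k1 r) choice \<phi> m $ i =
    row_vec_mult m (psmc_G1 k1 P) $ i - choice \<phi> m"
  using assms row_vec_mult_carrier[OF psmc_G1_carrier[OF assms(1)], of m]
  by (simp add: psmc_encoder_def Let_def row_psmc_G0)

text \<open>Error correction enters only through \<open>unique\<close>, which fixes the value of the
  \<open>THE\<close>; what remains is to invert the encoder on an error-free codeword.\<close>

lemma psmc_decoder_eq:
  fixes P :: "'a::field mat"
  assumes P: "P \<in> carrier_mat k1 r" and m: "m \<in> carrier_vec k1"
    and unique: "\<And>x. nearby_codeword C t y x \<longleftrightarrow>
      x = psmc_encoder (psmc_G1 k1 P) (psmc_G0 k1 r) choice \<phi> m"
  shows "psmc_decoder C t k1 (psmc_G0 k1 r) y = m"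
proof -
  define c where "c = psmc_encoder (psmc_G1 k1 P) (psmc_G0 k1 r) choice \<phi> m"
  note G1 = psmc_G1_carrier[OF P]
  \<comment> \<open>Column 0 of \<open>psmc_G1 k1 P\<close> is zero, so the message contributes
    nothing to this entry.\<close>
  have c0: "c $ 0 = - choice \<phi> m"
    using m by (simp add: c_def index_psmc_encoder[OF P] index_row_vec_mult[OF G1] col_psmc_G1_0[OF P])
  \<comment> \<open>Column \<open>Suc j\<close> is the unit vector with index \<open>j\<close>, the
    offset by one being due to the zero column.\<close>
  have cS: "c $ Suc j = m $ j - choice \<phi> m" if "j < k1" for j
    using m that
    by (simp add: c_def index_psmc_encoder[OF P] index_row_vec_mult[OF G1] col_psmc_G1_Suc[OF P])
  have "(THE x. nearby_codeword C t y x) = c"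
    by (simp add: unique c_def)
  then show ?thesis
    using m by (intro eq_vecI) (auto simp: psmc_decoder_def Let_def c0 cS row_psmc_G0)
qed

text \<open>Pigeonhole: the entries at the positions in \<open>\<phi>\<close> form a set smaller
  than the field.\<close>

lemma masking_scalar_exists:
  fixes G1 :: "'a::{field, finite} mat"
  assumes "finite \<phi>" "card \<phi> < card (UNIV :: 'a set)"
  shows "\<exists>v. masking_scalar G1 \<phi> m v"
proof -
  have "card ((\<lambda>i. row_vec_mult m G1 $ i) ` \<phi>) < card (UNIV :: 'a set)"
    using card_image_le[OF assms(1)] assms(2) by (rule le_less_trans)
  then have "(\<lambda>i. row_vec_mult m G1 $ i) ` \<phi> \<noteq> UNIV" by auto
  then obtain v where "v \<notin> (\<lambda>i. row_vec_mult m G1 $ i) ` \<phi>"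
    by (metis UNIV_eq_I)
  then show ?thesis unfolding masking_scalar_def by (metis imageI)
qed

text \<open>\<open>level\<close> is injective and maps 0 to 0, so only the zero element has level
  below 1.\<close>

lemma storable_1_iff:
  "level_identification q level \<Longrightarrow> storable level 1 x \<longleftrightarrow> x \<noteq> 0"
  unfolding level_identification_def storable_def bij_betw_def
  by (metis One_nat_def Suc_leI UNIV_I inj_on_eq_iff not_one_le_zero neq0_conv)

text \<open>The first conjunct ensures that admissible functions \<open>choice\<close> exist, so the
  claim about all of them is not vacuous. The unique existence shows that the \<open>THE\<close> in
  the decoder is well defined on received words.\<close>

theorem theorem1:
  fixes level :: "'a::{field, finite} \<Rightarrow> nat"
    and q n t u r k1 k d :: nat
    and P :: "'a mat"
    and C C1 :: "'a vec set"
  assumes q: "card (UNIV :: 'a set) = q"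
    and level: "level_identification q level"
    and k1: "k1 = n - 1 - r" "k1 \<ge> 1"
    and k: "k = k1 + 1"
    and u: "u \<le> min n (q - 1)"
    and P: "P \<in> carrier_mat k1 r"
    and C1: "vec_space.linear_code n k1 C1"
      "vec_space.generator_matrix n k1 (psmc_G1 k1 P) C1"
    and C: "vec_space.linear_code_dist n k d C"
      "vec_space.generator_matrix n k (psmc_G1 k1 P @\<^sub>r psmc_G0 k1 r) C"
    and d: "d \<ge> 2 * t + 1"
  shows "(\<forall>\<phi>\<in>stuck_sets n u. \<forall>m\<in>carrier_vec k1. \<exists>v. masking_scalar (psmc_G1 k1 P) \<phi> m v) \<and>
    (\<forall>choice.
      (\<forall>\<phi>\<in>stuck_sets n u. \<forall>m\<in>carrier_vec k1.
         masking_scalar (psmc_G1 k1 P) \<phi> m (choice \<phi> m)) \<longrightarrow>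
      (\<forall>\<phi>\<in>stuck_sets n u. \<forall>m\<in>carrier_vec k1. \<forall>e\<in>carrier_vec n. hamming_weight e \<le> t \<longrightarrow>
         (\<exists>!x. nearby_codeword C t
            (psmc_encoder (psmc_G1 k1 P) (psmc_G0 k1 r) choice \<phi> m + e) x)) \<and>
      is_PSMC level n u t (carrier_vec k1)
        (psmc_encoder (psmc_G1 k1 P) (psmc_G0 k1 r) choice)
        (psmc_decoder C t k1 (psmc_G0 k1 r)))"
proof (intro conjI allI impI)
  \<comment> \<open>Subtraction on naturals truncates at zero; \<open>k1 \<ge> 1\<close> rules this
    out.\<close>
  have n: "n = 1 + k1 + r" using k1 by linarith
  let ?G1 = "psmc_G1 k1 P" and ?G0 = "psmc_G0 k1 r"
  have G: "?G1 @\<^sub>r ?G0 \<in> carrier_mat (k1 + 1) n"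
    unfolding n by (rule carrier_append_rows[OF psmc_G1_carrier[OF P] psmc_G0_carrier])
  have C_eq: "C = (\<lambda>x. row_vec_mult x (?G1 @\<^sub>r ?G0)) ` carrier_vec (k1 + 1)"
    using C(2) vec_space.row_space_eq_row_vec_mult[OF G] by (simp add: vec_space.generator_matrix_def)
  have C_sub: "C \<subseteq> carrier_vec n"
    using C_eq row_vec_mult_carrier[OF G] by auto
  have C_min: "2 * t + 1 \<le> minimum_distance C"
    using C(1) d by (simp add: vec_space.linear_code_dist_def)
  \<comment> \<open>For the same reason \<open>u \<le> q - 1\<close> yields \<open>u < q\<close>
    only when \<open>q\<close> is positive.\<close>
  have "0 < q"
    using q finite_UNIV_card_ge_0[where 'a = 'a] by simp
  then show "\<forall>\<phi>\<in>stuck_sets n u. \<forall>m\<in>carrier_vec k1. \<exists>v. masking_scalar ?G1 \<phi> m v"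
    using u q finite_subset[of _ "{0..<n}"]
    by (intro ballI masking_scalar_exists) (auto simp: stuck_sets_def)

  fix choice
  assume choice: "\<forall>\<phi>\<in>stuck_sets n u. \<forall>m\<in>carrier_vec k1. masking_scalar ?G1 \<phi> m (choice \<phi> m)"
  let ?enc = "psmc_encoder ?G1 ?G0 choice"
  have enc_C: "?enc \<phi> m \<in> C" if "m \<in> carrier_vec k1" for \<phi> m
    unfolding C_eq psmc_encoder_eq_row_vec_mult[OF P that]
    using that by (intro imageI append_carrier_vec vec_carrier)
  have unique: "nearby_codeword C t (?enc \<phi> m + e) x \<longleftrightarrow> x = ?enc \<phi> m"
    if "m \<in> carrier_vec k1" "e \<in> carrier_vec n" "hamming_weight e \<le> t" for \<phi> m e x
    by (rule nearby_codeword_add_iff[OF C_sub C_min enc_C[OF that(1)] that(2,3)])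
  then show "\<forall>\<phi>\<in>stuck_sets n u. \<forall>m\<in>carrier_vec k1. \<forall>e\<in>carrier_vec n.
      hamming_weight e \<le> t \<longrightarrow> (\<exists>!x. nearby_codeword C t (?enc \<phi> m + e) x)"
    by simp
  show "is_PSMC level n u t (carrier_vec k1) ?enc (psmc_decoder C t k1 ?G0)"
    unfolding is_PSMC_def
  proof (intro ballI conjI impI)
    fix \<phi> and m :: "'a vec"
    assume \<phi>: "\<phi> \<in> stuck_sets n u" and m: "m \<in> carrier_vec k1"
    show "?enc \<phi> m \<in> carrier_vec n" using enc_C[OF m] C_sub by auto
    show "storable level 1 (?enc \<phi> m $ i)" if i: "i \<in> \<phi>" for i
    proof -
      have "i < 1 + k1 + r" using i \<phi> n by (auto simp: stuck_sets_def)
      moreover have "row_vec_mult m ?G1 $ i \<noteq> choice \<phi> m"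
        using choice \<phi> m i by (auto simp: masking_scalar_def)
      \<comment> \<open>The stored entry is the difference of these two unequal field
        elements.\<close>
      ultimately show ?thesis
        by (simp add: storable_1_iff[OF level] index_psmc_encoder[OF P] del: One_nat_def)
    qed
    show "psmc_decoder C t k1 ?G0 (?enc \<phi> m + e) = m"
      if "e \<in> carrier_vec n" "hamming_weight e \<le> t" for e
      by (rule psmc_decoder_eq[OF P m unique[OF m that]])
  qed
qed

end
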